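(* For every real $\alpha$ with $1/2<\alpha<1$ there exists $\Delta=\Delta(\alpha)>0$ such that for every integer $k\ge1$, every real $K\ge1$ and all reals $0<c_1<c_2$ there is a constant $\kappa>0$ (depending only on $\alpha,k,K,c_1,c_2$) for which the following holds. Let $p$ be a prime, let $G$ be a subgroup of $\mathbb{F}_p^*$, let $g,h:G\to\mathbb{F}_p^*$ be functions and let $f(x,y)=g(x)h(y)(x^k+y^k)$ for $x,y\in G$. Assume that for each fixed $z\in G$, each of the functions $x\mapsto g(xz)/g(x)$ and $x\mapsto h(xz)/h(x)$ takes at most $K$ different values when $x$ runs over $G$, and that $\max_{u\in G}\mu(g\cdot h_u\cdot\mathrm{id})\le K$, where $h_u(x)=h(ux)$. Let $w:G\to\mathbb{F}_p$ be a function with $\mu(w)\le K$ and put $P_w(f)(x,y)=w(x)f(x,y)$. Then for any $A\subset G$ with $c_1p^{\alpha}<|A|<c_2p^{\alpha}$, $$\max\big(|f(A,A)|,\,|P_w(f)(A,A)|\big)\ge\kappa|A|^{1+\Delta}.$$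
   Context: $\mathbb{F}_p$ is the field with $p$ elements and $\mathbb{F}_p^*=\mathbb{F}_p\setminus\{0\}$ its multiplicative group. For a function $\varphi:G\to\mathbb{F}_p$, $\mu(\varphi)=\max_{t\in\mathbb{F}_p}|\{x\in G:\varphi(x)=t\}|$. The function $g\cdot h_u\cdot\mathrm{id}$ is $x\mapsto g(x)h(ux)x$ on $G$. For a two-variable function $F$, $F(A,A)=\{F(a,b): a,b\in A\}$. *)

theory Defs
  imports Complex_Main "HOL-Number_Theory.Residues"
begin

text \<open>
  The field with \<open>p\<close> elements is the library's residue ring, with carrier \<open>{0..p - 1}\<close> of type
  \<^typ>\<open>int\<close>. It is not rendered as a type because the constants of the theorem have to be chosen
  before \<open>p\<close>. A function defined on a subset of the field is a total function on \<^typ>\<open>int\<close> whose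
  values outside that subset are irrelevant.
\<close>

abbreviation Fp :: "nat \<Rightarrow> int ring" where
  "Fp p \<equiv> residue_ring (int p)"

abbreviation Fp_star :: "nat \<Rightarrow> int monoid" where
  "Fp_star p \<equiv> mult_of (Fp p)"

definition max_mult :: "nat \<Rightarrow> int set \<Rightarrow> (int \<Rightarrow> int) \<Rightarrow> nat" (\<open>\<mu>\<close>) where
  "\<mu> p G \<phi> = (MAX t\<in>carrier (Fp p). card {x \<in> G. \<phi> x = t})"

definition ratio_values :: "nat \<Rightarrow> int set \<Rightarrow> (int \<Rightarrow> int) \<Rightarrow> int \<Rightarrow> int set" where
  "ratio_values p G g z = (\<lambda>x. g (x \<otimes>\<^bsub>Fp p\<^esub> z) \<otimes>\<^bsub>Fp p\<^esub> inv\<^bsub>Fp p\<^esub> (g x)) ` G"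

definition translate :: "nat \<Rightarrow> (int \<Rightarrow> int) \<Rightarrow> int \<Rightarrow> int \<Rightarrow> int" where
  "translate p h u = (\<lambda>x. h (u \<otimes>\<^bsub>Fp p\<^esub> x))"

definition fun_mult :: "nat \<Rightarrow> (int \<Rightarrow> int) \<Rightarrow> (int \<Rightarrow> int) \<Rightarrow> int \<Rightarrow> int" where
  "fun_mult p \<phi> \<psi> = (\<lambda>x. \<phi> x \<otimes>\<^bsub>Fp p\<^esub> \<psi> x)"

definition twisted_power_sum ::
    "nat \<Rightarrow> nat \<Rightarrow> (int \<Rightarrow> int) \<Rightarrow> (int \<Rightarrow> int) \<Rightarrow> int \<Rightarrow> int \<Rightarrow> int" where
  "twisted_power_sum p k g h x y =
     g x \<otimes>\<^bsub>Fp p\<^esub> h y \<otimes>\<^bsub>Fp p\<^esub> (x [^]\<^bsub>Fp p\<^esub> k \<oplus>\<^bsub>Fp p\<^esub> y [^]\<^bsub>Fp p\<^esub> k)"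

definition P_op :: "nat \<Rightarrow> (int \<Rightarrow> int) \<Rightarrow> (int \<Rightarrow> int \<Rightarrow> int) \<Rightarrow> int \<Rightarrow> int \<Rightarrow> int" where
  "P_op p w F x y = w x \<otimes>\<^bsub>Fp p\<^esub> F x y"

definition value_set :: "(int \<Rightarrow> int \<Rightarrow> int) \<Rightarrow> int set \<Rightarrow> int set" where
  "value_set F A = {F a b | a b. a \<in> A \<and> b \<in> A}"

end

theory Submission
  imports Defs "HOL-Analysis.Convex"
begin

text \<open>
Write \<open>N\<close> for the size of \<open>A\<close>, \<open>X = f(A, A)\<close>, \<open>Y = P_w(f)(A, A)\<close>, and let \<open>B\<close> be the set of
\<open>x \<in> A\<close> with \<open>w(x) \<noteq> 0\<close>. The argument shows that \<open>X\<close> and \<open>Y\<close> cannot both be small by counting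
triples \<open>(x, y, x') \<in> B \<times> A \<times> B\<close> for which the value \<open>f(x, y)\<close> also occurs in the row of \<open>x'\<close>, that
is, \<open>f(x, y) = f(x', y')\<close> for some \<open>y' \<in> A\<close>.

If \<open>X\<close> is small, there are many such triples. A row \<open>f(x, \<cdot>)\<close> may well have few values, but this is
exceptional: for \<open>y\<close> and \<open>y'\<close> with different \<open>k\<close>-th powers, the equation \<open>f(x, y) = f(x, y')\<close>
determines \<open>x^k\<close>. So the rows take \<open>N\<^sup>2\<close> values altogether, up to a constant
(\<open>square_card_le_sum_row_images\<close>), and as all of them lie in \<open>X\<close>, Cauchy-Schwarz gives about
\<open>N^4 / |X|\<close> triples (\<open>square_sum_row_images_le\<close>).

If \<open>Y\<close> is small, there are few. For each triple, \<open>v = w(x') f(x, y) = w(x') f(x', y')\<close> belongs to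
\<open>Y\<close>, and
  \<open>v / g(x) = w(x') h(y) \<cdot> x^k + w(x') h(y) y^k\<close>
says that the point \<open>(x^k, v / g(x))\<close>, one of at most \<open>N |Y|\<close>, lies on the line with slope
\<open>w(x') h(y)\<close> and intercept \<open>w(x') h(y) y^k\<close>, one of at most \<open>N\<^sup>2\<close>. Since \<open>w\<close> has bounded
multiplicity, boundedly many triples yield the same incidence. Over a field with \<open>p\<close> elements, a
set \<open>P\<close> of points and a set \<open>L\<close> of lines have at most \<open>|P| |L| / p + sqrt (p |P| |L|)\<close> incidences
(\<open>affine_incidence_bound\<close>), so there are at most about \<open>N\<^sup>3 |Y| / p + sqrt (p N\<^sup>3 |Y|)\<close> triples
(\<open>card_shared_values_le\<close>).

With \<open>M = max |X| |Y|\<close>, comparing the two counts leaves \<open>M\<^sup>2 \<ge> c N p\<close> or \<open>M\<^sup>3 \<ge> c N^5 / p\<close>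
(\<open>twisted_sum_image_bound\<close>, \<open>incidence_dichotomy\<close>). As \<open>p\<close> has the order of \<open>N powr (1 / \<alpha>)\<close>,
this bounds \<open>M\<close> below by a constant times \<open>N\<close> to the power \<open>(1 + 1 / \<alpha>) / 2\<close> or
\<open>(5 - 1 / \<alpha>) / 3\<close>. The first exponent exceeds 1 because \<open>\<alpha> < 1\<close>, the second because \<open>\<alpha> > 1/2\<close>.
\<close>

section \<open>Counting by fibres and second moments\<close>

lemma card_le_fibre_bound:
  assumes "finite S" and "\<phi> ` S \<subseteq> B" and "finite B"
    and fibre: "\<And>s. s \<in> S \<Longrightarrow> card {s' \<in> S. \<phi> s' = \<phi> s} \<le> c"
  shows "card S \<le> c * card B"
proof -
  have "card S = (\<Sum>b\<in>\<phi> ` S. card {s' \<in> S. \<phi> s' = b})"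
    using sum.image_gen[OF \<open>finite S\<close>, of "\<lambda>_. 1::nat" \<phi>] by simp
  also have "\<dots> \<le> (\<Sum>b\<in>\<phi> ` S. c)"
    by (intro sum_mono) (auto intro: fibre)
  also have "\<dots> \<le> c * card B"
    using card_mono[OF \<open>finite B\<close> \<open>\<phi> ` S \<subseteq> B\<close>] by simp
  finally show ?thesis .
qed

lemma card_Sigma_le:
  assumes "finite S" and "\<And>x. x \<in> S \<Longrightarrow> finite (F x)" and "\<And>x. x \<in> S \<Longrightarrow> card (F x) \<le> c"
  shows "card (SIGMA x:S. F x) \<le> card S * c"
  using assms sum_bounded_above[of S "\<lambda>x. card (F x)" c] by simp

text \<open>
Cauchy-Schwarz over the fibres of \<open>\<phi>\<close>: few collisions force many values.
\<close>

lemma square_card_le_image_collisions: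
  assumes "finite A"
  shows "(card A)\<^sup>2 \<le> card (\<phi> ` A) * card {(y, y') \<in> A \<times> A. \<phi> y = \<phi> y'}"
proof -
  define F where "F v = {y \<in> A. \<phi> y = v}" for v
  have finF: "finite (F v)" for v using assms by (simp add: F_def)
  have "card A = (\<Sum>v\<in>\<phi> ` A. card (F v))"
    using sum.image_gen[OF assms, of "\<lambda>_. 1::nat" \<phi>] by (simp add: F_def)
  moreover have "card {(y, y') \<in> A \<times> A. \<phi> y = \<phi> y'} = (\<Sum>v\<in>\<phi> ` A. (card (F v))\<^sup>2)"
  proof -
    have "{(y, y') \<in> A \<times> A. \<phi> y = \<phi> y'} = (\<Union>v\<in>\<phi> ` A. F v \<times> F v)"
      by (auto simp: F_def)
    also have "card \<dots> = (\<Sum>v\<in>\<phi> ` A. card (F v \<times> F v))"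
      using assms finF by (intro card_UN_disjoint) (auto simp: F_def)
    finally show ?thesis by (simp add: power2_eq_square card_cartesian_product)
  qed
  moreover have "(\<Sum>v\<in>\<phi> ` A. real (card (F v)))\<^sup>2
      \<le> (\<Sum>v\<in>\<phi> ` A. (real (card (F v)))\<^sup>2) * real (card (\<phi> ` A))"
    by (rule sum_squared_le_sum_of_squares)
  ultimately have "real ((card A)\<^sup>2) \<le> real (card (\<phi> ` A) * card {(y, y') \<in> A \<times> A. \<phi> y = \<phi> y'})"
    by (simp add: mult.commute)
  then show ?thesis by (simp only: of_nat_le_iff)
qed

text \<open>
The sum on the left counts the pairs of a row \<open>x\<close> and a value \<open>v\<close> of that row. By Cauchy-Schwarz
over \<open>v \<in> X\<close>, many such pairs force many coincidences of a value between two rows \<open>x\<close> and \<open>x'\<close>.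
The right-hand side counts each coincidence once for every \<open>y\<close> with \<open>f x y = v\<close>; the triples have
this form because \<open>y\<close> is one of the parameters of the line attached to them later.
\<close>

lemma square_sum_row_images_le:
  assumes fin: "finite A" "finite X" and "B \<subseteq> A"
    and X: "\<And>x y. x \<in> A \<Longrightarrow> y \<in> A \<Longrightarrow> f x y \<in> X"
  shows "(real (\<Sum>x\<in>B. card (f x ` A)))\<^sup>2
          \<le> real (card X) * real (card {(x, y, x') \<in> B \<times> A \<times> B. f x y \<in> f x' ` A})"
proof -
  define D where "D v = {x \<in> B. v \<in> f x ` A}" for v
  define T where "T = {(x, y, x') \<in> B \<times> A \<times> B. f x y \<in> f x' ` A}"
  have finB: "finite B" using finite_subset[OF \<open>B \<subseteq> A\<close>] fin by simp
  have finD: "finite (D v)" for v using finB by (simp add: D_def)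
  have finT: "finite T"
    by (rule finite_subset[of _ "B \<times> A \<times> B"]) (auto simp: T_def finB fin)
  have "(\<Sum>x\<in>B. card (f x ` A)) = card (SIGMA x:B. f x ` A)"
    using finB fin by simp
  also have "\<dots> = card (SIGMA v:X. D v)"
  proof (rule bij_betw_same_card[where f = prod.swap])
    show "bij_betw prod.swap (SIGMA x:B. f x ` A) (SIGMA v:X. D v)"
      by (rule bij_betwI[where g = prod.swap]) (use X \<open>B \<subseteq> A\<close> in \<open>auto simp: D_def\<close>)
  qed
  also have "\<dots> = (\<Sum>v\<in>X. card (D v))"
    using fin finD by simp
  finally have S: "real (\<Sum>x\<in>B. card (f x ` A)) = (\<Sum>v\<in>X. real (card (D v)))" by simp
  have "(\<Sum>v\<in>X. (card (D v))\<^sup>2) = card (SIGMA v:X. D v \<times> D v)"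
    using fin finD by (simp add: power2_eq_square card_cartesian_product)
  also have "\<dots> \<le> card T"
  proof (rule surj_card_le[OF finT, where f = "\<lambda>(x, y, x'). (f x y, x, x')"])
    show "(SIGMA v:X. D v \<times> D v) \<subseteq> (\<lambda>(x, y, x'). (f x y, x, x')) ` T"
    proof (intro subsetI, clarsimp simp: D_def)
      fix x x' y y' assume h: "x \<in> B" "x' \<in> B" "y \<in> A" "y' \<in> A" "f x y = f x' y'"
      show "(f x' y', x, x') \<in> (\<lambda>(x, y, x'). (f x y, x, x')) ` T"
        by (rule image_eqI[of _ _ "(x, y, x')"]) (use h in \<open>auto simp: T_def\<close>)
    qed
  qed
  finally have "(\<Sum>v\<in>X. (real (card (D v)))\<^sup>2) \<le> real (card T)"
    by (metis (mono_tags, lifting) of_nat_le_iff of_nat_power of_nat_sum sum.cong)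
  moreover have "(\<Sum>v\<in>X. real (card (D v)))\<^sup>2 \<le> (\<Sum>v\<in>X. (real (card (D v)))\<^sup>2) * real (card X)"
    by (rule sum_squared_le_sum_of_squares)
  ultimately show ?thesis
    unfolding S T_def[symmetric]
    by (smt (verit) mult.commute mult_right_mono of_nat_0_le_iff)
qed

section \<open>Incidences of points and lines over a finite field\<close>

lemma card_eq_sum_of_bool:
  "finite S \<Longrightarrow> real (card {x \<in> S. Q x}) = (\<Sum>x\<in>S. of_bool (Q x))"
  by (simp add: Int_def)

text \<open>
A finite affine plane seen combinatorially: \<open>q\<^sup>2\<close> points, lines of \<open>q\<close> points, and at most one point
common to two lines. On average a point lies on \<open>|L| / q\<close> lines of \<open>L\<close>, and as distinct lines hardly
meet, the sum over all points of the squared deviation from this average is at most \<open>q |L|\<close>.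
Restricting that sum to \<open>P\<close> and applying Cauchy-Schwarz gives the bound.
\<close>

lemma incidence_second_moment:
  fixes inc :: "'a \<Rightarrow> 'b \<Rightarrow> bool" and q :: nat
  assumes fin: "finite V" "finite L" and "P \<subseteq> V" and "q > 0" and cardV: "card V = q\<^sup>2"
    and line: "\<And>l. l \<in> L \<Longrightarrow> card {u \<in> V. inc u l} = q"
    and meet: "\<And>l l'. l \<in> L \<Longrightarrow> l' \<in> L \<Longrightarrow> l \<noteq> l' \<Longrightarrow> card {u \<in> V. inc u l \<and> inc u l'} \<le> 1"
  shows "real (card {(u, l) \<in> P \<times> L. inc u l})
          \<le> real (card P) * real (card L) / real q + sqrt (real q * (real (card P) * real (card L)))"
proof -
  define i :: "'a \<Rightarrow> real" where "i u = (\<Sum>l\<in>L. of_bool (inc u l))" for u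
  \<comment> \<open>The mean of \<open>i\<close> over the plane, by \<open>first\<close> below.\<close>
  define e where "e = real (card L) / real q"
  have q: "real q > 0" using \<open>q > 0\<close> by simp
  have finP: "finite P" using finite_subset[OF \<open>P \<subseteq> V\<close>] fin by simp
  have count: "real (card {(u, l) \<in> P \<times> L. inc u l}) = (\<Sum>u\<in>P. i u)"
  proof -
    have "{(u, l) \<in> P \<times> L. inc u l} = Sigma P (\<lambda>u. {l \<in> L. inc u l})" by auto
    then show ?thesis
      using finP fin by (simp add: i_def Int_def)
  qed
  have first: "(\<Sum>u\<in>V. i u) = real q * real (card L)"
  proof -
    have "(\<Sum>u\<in>V. i u) = (\<Sum>l\<in>L. \<Sum>u\<in>V. of_bool (inc u l))"
      unfolding i_def by (rule sum.swap)
    also have "\<dots> = (\<Sum>l\<in>L. real q)"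
      by (intro sum.cong refl) (metis card_eq_sum_of_bool fin(1) line)
    finally show ?thesis by simp
  qed
  have second: "(\<Sum>u\<in>V. (i u)\<^sup>2) \<le> real q * real (card L) + (real (card L))\<^sup>2"
  proof -
    have "(\<Sum>u\<in>V. (i u)\<^sup>2) = (\<Sum>u\<in>V. \<Sum>l\<in>L. \<Sum>l'\<in>L. of_bool (inc u l \<and> inc u l'))"
      unfolding i_def power2_eq_square by (simp add: sum_product of_bool_conj)
    also have "\<dots> = (\<Sum>l\<in>L. \<Sum>l'\<in>L. \<Sum>u\<in>V. of_bool (inc u l \<and> inc u l'))"
      by (subst sum.swap, intro sum.cong refl, rule sum.swap)
    \<comment> \<open>Only \<open>q\<close> is needed on the diagonal; allowing \<open>q + 1\<close> makes the sum evaluate neatly.\<close>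
    also have "\<dots> \<le> (\<Sum>l\<in>L. \<Sum>l'\<in>L. (if l = l' then real q else 0) + 1)"
    proof (intro sum_mono)
      fix l l' assume ll: "l \<in> L" "l' \<in> L"
      have "(\<Sum>u\<in>V. of_bool (inc u l \<and> inc u l')) = real (card {u \<in> V. inc u l \<and> inc u l'})"
        using card_eq_sum_of_bool[OF fin(1), of "\<lambda>u. inc u l \<and> inc u l'"] by simp
      also have "\<dots> \<le> (if l = l' then real q else 0) + 1"
        using line[OF ll(1)] meet[OF ll] by auto
      finally show "(\<Sum>u\<in>V. of_bool (inc u l \<and> inc u l')) \<le> (if l = l' then real q else 0) + 1" .
    qed
    also have "\<dots> = real q * real (card L) + (real (card L))\<^sup>2"
      using fin by (simp add: sum.distrib power2_eq_square distrib_left)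
    finally show ?thesis .
  qed
  have "(\<Sum>u\<in>V. (i u - e)\<^sup>2) = (\<Sum>u\<in>V. (i u)\<^sup>2) - 2 * e * (\<Sum>u\<in>V. i u) + real (card V) * e\<^sup>2"
    by (simp add: power2_diff sum.distrib sum_subtractf sum_distrib_left[symmetric] sum_distrib_right[symmetric])
  also have "\<dots> \<le> real q * real (card L)"
    using second unfolding first cardV e_def using q by (simp add: field_simps power2_eq_square)
  finally have var: "(\<Sum>u\<in>V. (i u - e)\<^sup>2) \<le> real q * real (card L)" .
  have "(\<Sum>u\<in>P. i u - e)\<^sup>2 \<le> (\<Sum>u\<in>P. (i u - e)\<^sup>2) * real (card P)"
    by (rule sum_squared_le_sum_of_squares)
  also have "\<dots> \<le> (\<Sum>u\<in>V. (i u - e)\<^sup>2) * real (card P)"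
    by (intro mult_right_mono sum_mono2 fin \<open>P \<subseteq> V\<close>) auto
  also have "\<dots> \<le> real q * (real (card P) * real (card L))"
    using mult_right_mono[OF var, of "real (card P)"] by (simp add: algebra_simps)
  finally have "(\<Sum>u\<in>P. i u - e) \<le> sqrt (real q * (real (card P) * real (card L)))"
    by (rule real_le_rsqrt)
  then show ?thesis
    unfolding count by (simp add: sum_subtractf e_def)
qed

context field
begin

text \<open>
A pair \<open>l\<close> encodes the non-vertical line of slope \<open>fst l\<close> and intercept \<open>snd l\<close>. Such
lines have one point over each abscissa, and subtracting their equations at two common points
leaves a product of the difference of slopes and the difference of abscissae that is zero.
\<close>

lemma affine_incidence_bound:
  assumes fin: "finite (carrier R)" and P: "P \<subseteq> carrier R \<times> carrier R" and L: "L \<subseteq> carrier R \<times> carrier R"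
  shows "real (card {(u, l) \<in> P \<times> L. snd u = fst l \<otimes> fst u \<oplus> snd l})
          \<le> real (card P) * real (card L) / real (order R)
            + sqrt (real (order R) * (real (card P) * real (card L)))"
proof (rule incidence_second_moment[where V = "carrier R \<times> carrier R"])
  show "finite L" using finite_subset[OF L] fin by simp
  show "order R > 0" using order_gt_0_iff_finite fin by simp
  show "card (carrier R \<times> carrier R) = (order R)\<^sup>2"
    by (simp add: order_def power2_eq_square card_cartesian_product)
next
  fix l assume "l \<in> L"
  then have l: "fst l \<in> carrier R" "snd l \<in> carrier R" using L by auto
  have "{u \<in> carrier R \<times> carrier R. snd u = fst l \<otimes> fst u \<oplus> snd l}
      = (\<lambda>x. (x, fst l \<otimes> x \<oplus> snd l)) ` carrier R"
    using l by auto
  then show "card {u \<in> carrier R \<times> carrier R. snd u = fst l \<otimes> fst u \<oplus> snd l} = order R"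
    by (simp add: card_image inj_on_def order_def)
next
  fix l l' assume "l \<in> L" "l' \<in> L" and ne: "l \<noteq> l'"
  then have l: "fst l \<in> carrier R" "snd l \<in> carrier R" "fst l' \<in> carrier R" "snd l' \<in> carrier R"
    using L by auto
  let ?I = "{u \<in> carrier R \<times> carrier R. snd u = fst l \<otimes> fst u \<oplus> snd l \<and> snd u = fst l' \<otimes> fst u \<oplus> snd l'}"
  have "u = v" if "u \<in> ?I" "v \<in> ?I" for u v
  proof -
    obtain x y x' y' where uv: "u = (x, y)" "v = (x', y')" by (cases u, cases v)
    have x: "x \<in> carrier R" "x' \<in> carrier R" using that uv by auto
    have e: "fst l \<otimes> x \<oplus> snd l = fst l' \<otimes> x \<oplus> snd l'" "fst l \<otimes> x' \<oplus> snd l = fst l' \<otimes> x' \<oplus> snd l'"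
      using that uv by auto
    have "(fst l \<ominus> fst l') \<otimes> (x \<ominus> x')
        = (fst l \<otimes> x \<oplus> snd l) \<ominus> (fst l' \<otimes> x \<oplus> snd l')
          \<ominus> ((fst l \<otimes> x' \<oplus> snd l) \<ominus> (fst l' \<otimes> x' \<oplus> snd l'))"
      using l x by algebra
    also have "\<dots> = \<zero>" using e l x by (simp add: r_neg a_minus_def)
    finally have "fst l \<ominus> fst l' = \<zero> \<or> x \<ominus> x' = \<zero>"
      using integral[of "fst l \<ominus> fst l'" "x \<ominus> x'"] l x by simp
    then have "fst l = fst l' \<or> x = x'" using l x by (simp add: r_right_minus_eq)
    moreover have "fst l \<noteq> fst l'"
    proof
      assume eq: "fst l = fst l'"
      then have "snd l = snd l'" using e(1) l x by simp
      then show False using eq ne by (simp add: prod_eq_iff)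
    qed
    ultimately show ?thesis using that uv by auto
  qed
  then show "card ?I \<le> 1"
    by (metis (no_types, lifting) One_nat_def card.infinite card_le_Suc0_iff_eq zero_le)
qed (use fin P in auto)

section \<open>Values of twisted power sums\<close>

abbreviation twisted_sum :: "nat \<Rightarrow> ('a \<Rightarrow> 'a) \<Rightarrow> ('a \<Rightarrow> 'a) \<Rightarrow> 'a \<Rightarrow> 'a \<Rightarrow> 'a" where
  "twisted_sum k g h x y \<equiv> g x \<otimes> h y \<otimes> (x [^] k \<oplus> y [^] k)"

text \<open>
Dividing by one solution turns the others into \<open>k\<close>-th roots of unity.
\<close>

lemma card_power_fibre_le:
  fixes k :: nat
  assumes fin: "finite (carrier R)" and k: "k \<ge> 1" and A: "A \<subseteq> carrier R - {\<zero>}"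
  shows "card {x \<in> A. x [^] k = c} \<le> k"
proof (cases "{x \<in> A. x [^] k = c} = {}")
  case False
  then obtain a where a: "a \<in> A" "a [^] k = c" by auto
  have aR: "a \<in> carrier R" "a \<noteq> \<zero>" using a A by auto
  then have aU: "a \<in> Units R" by (simp add: field_Units)
  have "card {x \<in> A. x [^] k = c} = card ((\<lambda>x. x \<otimes> inv a) ` {x \<in> A. x [^] k = c})"
  proof (intro card_image[symmetric] inj_onI)
    fix x y assume "x \<in> {x \<in> A. x [^] k = c}" "y \<in> {x \<in> A. x [^] k = c}" "x \<otimes> inv a = y \<otimes> inv a"
    moreover have "z \<otimes> inv a \<otimes> a = z" if "z \<in> A" for z
      using that A aU aR by (auto simp: m_assoc)
    ultimately show "x = y" by (metis (mono_tags, lifting) mem_Collect_eq)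
  qed
  also have "\<dots> \<le> card {x \<in> carrier R. x [^] k = \<one>}"
  proof (rule card_mono)
    show "(\<lambda>x. x \<otimes> inv a) ` {x \<in> A. x [^] k = c} \<subseteq> {x \<in> carrier R. x [^] k = \<one>}"
    proof clarsimp
      fix x assume x: "x \<in> A" "c = x [^] k"
      then have xR: "x \<in> carrier R" using A by auto
      have "(x \<otimes> inv a) [^] k = x [^] k \<otimes> inv a [^] k"
        using xR aU by (simp add: nat_pow_distrib)
      also have "\<dots> = (a \<otimes> inv a) [^] k"
        using x a aU aR by (simp only: nat_pow_distrib Units_inv_closed)
      finally have "(x \<otimes> inv a) [^] k = \<one>"
        using aU by simp
      then show "x \<otimes> inv a \<in> carrier R \<and> (x \<otimes> inv a) [^] k = \<one>"
        using xR aU by simp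
    qed
  qed (use fin in auto)
  also have "\<dots> \<le> k" using num_roots_le_deg[OF fin] k by simp
  finally show ?thesis .
next
  case True
  then show ?thesis by (simp only: card.empty)
qed

text \<open>
After cancelling \<open>g x\<close>, the equation \<open>f x y = f x y'\<close> is linear in \<open>x^k\<close> with leading coefficient
\<open>h y - h y'\<close>. It has a unique solution unless this coefficient vanishes, and then it forces
\<open>y^k = y'^k\<close>.
\<close>

lemma twisted_sum_collision_unique:
  assumes "g x \<in> carrier R - {\<zero>}" "g z \<in> carrier R - {\<zero>}"
    "h y \<in> carrier R - {\<zero>}" "h y' \<in> carrier R - {\<zero>}"
    "x \<in> carrier R" "z \<in> carrier R" "y \<in> carrier R" "y' \<in> carrier R"
    and eqx: "twisted_sum k g h x y = twisted_sum k g h x y'"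
    and eqz: "twisted_sum k g h z y = twisted_sum k g h z y'"
    and ne: "y [^] k \<noteq> y' [^] k"
  shows "x [^] k = z [^] k"
proof -
  have row: "h y \<otimes> (t [^] k \<oplus> y [^] k) = h y' \<otimes> (t [^] k \<oplus> y' [^] k)"
    if "g t \<in> carrier R - {\<zero>}" "t \<in> carrier R"
      "twisted_sum k g h t y = twisted_sum k g h t y'" for t
  proof -
    have "g t \<otimes> (h y \<otimes> (t [^] k \<oplus> y [^] k)) = g t \<otimes> (h y' \<otimes> (t [^] k \<oplus> y' [^] k))"
      using that assms by (simp add: m_assoc)
    then show ?thesis
      using that assms by (subst (asm) m_lcancel) auto
  qed
  have C: "x [^] k \<in> carrier R" "z [^] k \<in> carrier R" "y [^] k \<in> carrier R" "y' [^] k \<in> carrier R"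
     "h y \<in> carrier R" "h y' \<in> carrier R"
    using assms by auto
  \<comment> \<open>Subtracting the equations for \<open>x\<close> and \<open>z\<close> eliminates their constant term.\<close>
  have "(h y \<ominus> h y') \<otimes> (x [^] k \<ominus> z [^] k)
     = (h y \<otimes> (x [^] k \<oplus> y [^] k) \<ominus> h y' \<otimes> (x [^] k \<oplus> y' [^] k))
       \<ominus> (h y \<otimes> (z [^] k \<oplus> y [^] k) \<ominus> h y' \<otimes> (z [^] k \<oplus> y' [^] k))"
    using C by algebra
  also have "\<dots> = \<zero>"
    using row[of x] row[of z] assms C by (simp add: r_neg a_minus_def)
  finally have "h y \<ominus> h y' = \<zero> \<or> x [^] k \<ominus> z [^] k = \<zero>"
    using integral[of "h y \<ominus> h y'" "x [^] k \<ominus> z [^] k"] C by simp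
  moreover have "h y \<noteq> h y'"
  proof
    assume "h y = h y'"
    then have "x [^] k \<oplus> y [^] k = x [^] k \<oplus> y' [^] k"
      using row[of x] assms C by (simp add: m_lcancel)
    then show False using ne C by simp
  qed
  ultimately show ?thesis using C by (simp add: r_right_minus_eq)
qed

text \<open>
Pairs with \<open>y^k = y'^k\<close> may collide in every row, but there are at most \<open>k |A|\<close> of them; any other
pair collides in at most \<open>k\<close> rows. Each kind contributes at most \<open>k |A|\<^sup>2\<close>.
\<close>

lemma sum_row_collisions_le:
  fixes k :: nat
  assumes fin: "finite (carrier R)" and k: "k \<ge> 1" and A: "A \<subseteq> carrier R - {\<zero>}"
    and g: "g \<in> A \<rightarrow> carrier R - {\<zero>}" and h: "h \<in> A \<rightarrow> carrier R - {\<zero>}"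
  shows "(\<Sum>x\<in>A. card {(y, y') \<in> A \<times> A. twisted_sum k g h x y = twisted_sum k g h x y'})
           \<le> 2 * k * (card A)\<^sup>2"
proof -
  let ?f = "twisted_sum k g h"
  let ?C = "\<lambda>x. {(y, y') \<in> A \<times> A. ?f x y = ?f x y'}"
  define Triv where "Triv = A \<times> (SIGMA y:A. {y' \<in> A. y' [^] k = y [^] k})"
  define Rest where "Rest = {(x, y, y') \<in> A \<times> A \<times> A. ?f x y = ?f x y' \<and> y [^] k \<noteq> y' [^] k}"
  have finA: "finite A" using finite_subset[OF A] fin by simp
  have finR: "finite Rest"
    by (rule finite_subset[of _ "A \<times> A \<times> A"]) (auto simp: Rest_def finA)
  have finT: "finite Triv" using finA by (simp add: Triv_def)
  have Triv: "card Triv \<le> k * (card A)\<^sup>2"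
  proof -
    have "card (SIGMA y:A. {y' \<in> A. y' [^] k = y [^] k}) \<le> card A * k"
      by (rule card_Sigma_le) (use finA card_power_fibre_le[OF fin k A] in auto)
    then show ?thesis
      by (simp add: Triv_def card_cartesian_product power2_eq_square mult_ac)
  qed
  have Rest: "card Rest \<le> k * (card A)\<^sup>2"
  proof -
    have "card Rest \<le> k * card (A \<times> A)"
    proof (rule card_le_fibre_bound[where \<phi> = snd])
      fix s assume "s \<in> Rest"
      then obtain z y y' where s: "s = (z, y, y')" and zyy: "z \<in> A" "y \<in> A" "y' \<in> A"
        "?f z y = ?f z y'" "y [^] k \<noteq> y' [^] k" by (auto simp: Rest_def)
      have "{s' \<in> Rest. snd s' = snd s} \<subseteq> {x \<in> A. x [^] k = z [^] k} \<times> {(y, y')}"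
      proof clarsimp
        fix x assume "(x, snd s) \<in> Rest"
        then have "x \<in> A" "?f x y = ?f x y'" by (auto simp: Rest_def s)
        moreover from this have "x [^] k = z [^] k"
          by (intro twisted_sum_collision_unique[where y = y and y' = y' and g = g and h = h])
             (use zyy A g h in auto)
        ultimately show "x \<in> A \<and> x [^] k = z [^] k \<and> snd s = (y, y')" by (simp add: s)
      qed
      then have "card {s' \<in> Rest. snd s' = snd s} \<le> card ({x \<in> A. x [^] k = z [^] k} \<times> {(y, y')})"
        by (intro card_mono) (use finA in auto)
      also have "\<dots> \<le> k"
        using card_power_fibre_le[OF fin k A] by (simp add: card_cartesian_product)
      finally show "card {s' \<in> Rest. snd s' = snd s} \<le> k" .
    qed (use finR finA in \<open>auto simp: Rest_def\<close>)
    then show ?thesis by (simp add: card_cartesian_product power2_eq_square)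
  qed
  have "finite (?C x)" for x
    by (rule finite_subset[of _ "A \<times> A"]) (auto simp: finA)
  then have "(\<Sum>x\<in>A. card (?C x)) = card (SIGMA x:A. ?C x)"
    using finA by simp
  also have "\<dots> \<le> card (Triv \<union> Rest)"
    by (rule card_mono) (use finT finR in \<open>auto simp: Triv_def Rest_def\<close>)
  also have "\<dots> \<le> card Triv + card Rest" by (rule card_Un_le)
  also have "\<dots> \<le> 2 * k * (card A)\<^sup>2" using Triv Rest by simp
  finally show ?thesis .
qed

text \<open>
A single row can be constant, for instance when \<open>h y = 1 / (a^k + y^k)\<close> in the row of \<open>a\<close>, so the
number of values is bounded only in total over \<open>B\<close>, from the total number of collisions.
\<close>

lemma square_card_le_sum_row_images:
  fixes k :: nat
  assumes fin: "finite (carrier R)" and k: "k \<ge> 1" and A: "A \<subseteq> carrier R - {\<zero>}"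
    and g: "g \<in> A \<rightarrow> carrier R - {\<zero>}" and h: "h \<in> A \<rightarrow> carrier R - {\<zero>}"
    and B: "B \<subseteq> A"
  shows "(real (card B))\<^sup>2 \<le> 2 * real k * real (\<Sum>x\<in>B. card (twisted_sum k g h x ` A))"
proof (cases "card A = 0")
  case True
  moreover have "finite A" using finite_subset[OF A] fin by simp
  ultimately have "B = {}" using B by simp
  then show ?thesis by simp
next
  case False
  have finA: "finite A" using finite_subset[OF A] fin by simp
  define N where "N = real (card A)"
  define d where "d x = real (card (twisted_sum k g h x ` A))" for x
  define c where "c x = real (card {(y, y') \<in> A \<times> A. twisted_sum k g h x y = twisted_sum k g h x y'})" for x
  have dc: "d x \<ge> 0" "c x \<ge> 0" for x by (simp_all add: d_def c_def)
  have NB: "N \<le> sqrt (d x) * sqrt (c x)" for x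
  proof -
    have "N\<^sup>2 \<le> d x * c x"
      unfolding N_def d_def c_def
      using square_card_le_image_collisions[OF finA, of "twisted_sum k g h x"]
      by (simp only: of_nat_le_iff flip: of_nat_mult of_nat_power)
    then show ?thesis using real_le_rsqrt by (simp flip: real_sqrt_mult)
  qed
  have "(\<Sum>x\<in>A. c x) \<le> 2 * real k * N\<^sup>2"
  proof -
    have "real (\<Sum>x\<in>A. card {(y, y') \<in> A \<times> A. twisted_sum k g h x y = twisted_sum k g h x y'})
          \<le> real (2 * k * (card A)\<^sup>2)"
      using sum_row_collisions_le[OF fin k A g h] by (simp only: of_nat_le_iff)
    then show ?thesis by (simp add: c_def N_def)
  qed
  moreover have "(\<Sum>x\<in>B. c x) \<le> (\<Sum>x\<in>A. c x)"
    by (rule sum_mono2[OF finA B]) (simp add: c_def)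
  ultimately have cB: "(\<Sum>x\<in>B. c x) \<le> 2 * real k * N\<^sup>2" by linarith
  \<comment> \<open>Cauchy-Schwarz turns the bound on the sum of the \<open>c x\<close> into one on the sum of the \<open>d x\<close>.\<close>
  have "(real (card B) * N)\<^sup>2 = (\<Sum>x\<in>B. N)\<^sup>2" by simp
  also have "\<dots> \<le> (\<Sum>x\<in>B. sqrt (d x) * sqrt (c x))\<^sup>2"
    by (intro power_mono sum_mono NB sum_nonneg) (simp add: N_def)
  also have "\<dots> \<le> (\<Sum>x\<in>B. (sqrt (d x))\<^sup>2) * (\<Sum>x\<in>B. (sqrt (c x))\<^sup>2)"
    by (rule Cauchy_Schwarz_ineq_sum)
  also have "\<dots> = (\<Sum>x\<in>B. d x) * (\<Sum>x\<in>B. c x)" by (simp add: dc)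
  also have "\<dots> \<le> (\<Sum>x\<in>B. d x) * (2 * real k * N\<^sup>2)"
    by (intro mult_left_mono cB sum_nonneg dc)
  finally have "(real (card B))\<^sup>2 * N\<^sup>2 \<le> (2 * real k * (\<Sum>x\<in>B. d x)) * N\<^sup>2"
    by (simp add: power_mult_distrib mult_ac)
  moreover have "N\<^sup>2 > 0" using False by (simp add: N_def)
  ultimately have "(real (card B))\<^sup>2 \<le> 2 * real k * (\<Sum>x\<in>B. d x)"
    by (simp only: mult_le_cancel_right_pos)
  then show ?thesis by (simp add: d_def)
qed

text \<open>
The incidence count. A triple is sent to a point in the image of \<open>A \<times> Y\<close> and a line in the image of
\<open>B \<times> A\<close>. The point lies in the right set because the shared value lets \<open>w x'\<close> multiply a value of
its own row. An incidence determines \<open>x^k\<close> from the point, then \<open>y^k\<close> as intercept over slope, and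
finally \<open>w x'\<close> from \<open>y\<close> and the slope, so it comes from at most \<open>k \<cdot> k \<cdot> m\<close> triples.
\<close>

lemma card_shared_values_le:
  fixes k :: nat
  assumes fin: "finite (carrier R)" and k: "k \<ge> 1" and A: "A \<subseteq> carrier R - {\<zero>}"
    and g: "g \<in> A \<rightarrow> carrier R - {\<zero>}" and h: "h \<in> A \<rightarrow> carrier R - {\<zero>}"
    and B: "B \<subseteq> A" and w: "w \<in> B \<rightarrow> carrier R - {\<zero>}"
    and mult: "\<And>t. t \<in> carrier R \<Longrightarrow> card {x \<in> B. w x = t} \<le> m"
    and Y: "Y \<subseteq> carrier R" "\<And>x y. x \<in> B \<Longrightarrow> y \<in> A \<Longrightarrow> w x \<otimes> twisted_sum k g h x y \<in> Y"
  shows "real (card {(x, y, x') \<in> B \<times> A \<times> B. twisted_sum k g h x y \<in> twisted_sum k g h x' ` A})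
     \<le> (real k)\<^sup>2 * real m * (real (card A) ^ 3 * real (card Y) / real (order R)
          + sqrt (real (order R) * (real (card A) ^ 3 * real (card Y))))"
proof -
  let ?f = "twisted_sum k g h"
  define T where "T = {(x, y, x') \<in> B \<times> A \<times> B. ?f x y \<in> ?f x' ` A}"
  define P where "P = (\<lambda>(x, v). (x [^] k, v \<otimes> inv (g x))) ` (A \<times> Y)"
  define L where "L = (\<lambda>(x, y). (w x \<otimes> h y, w x \<otimes> h y \<otimes> y [^] k)) ` (B \<times> A)"
  define I where "I = {(u, l) \<in> P \<times> L. snd u = fst l \<otimes> fst u \<oplus> snd l}"
  define \<phi> where "\<phi> = (\<lambda>(x, y, x'). ((x [^] k, w x' \<otimes> ?f x y \<otimes> inv (g x)),
                                     (w x' \<otimes> h y, w x' \<otimes> h y \<otimes> y [^] k)))"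
  have finA: "finite A" using finite_subset[OF A] fin by simp
  have finB: "finite B" using finite_subset[OF B finA] .
  have finY: "finite Y" using finite_subset[OF Y(1) fin] .
  have finT: "finite T"
    by (rule finite_subset[of _ "B \<times> A \<times> B"]) (auto simp: T_def finA finB)
  have finPL: "finite P" "finite L" using finA finB finY by (simp_all add: P_def L_def)
  have finI: "finite I"
    by (rule finite_subset[of _ "P \<times> L"]) (auto simp: I_def finPL)
  have AR: "x \<in> carrier R" "g x \<in> Units R" "h x \<in> Units R" if "x \<in> A" for x
    using that A g h by (auto simp: field_Units)
  have wR: "w x \<in> Units R" if "x \<in> B" for x
    using that w by (auto simp: field_Units)
  have imI: "\<phi> ` T \<subseteq> I"
  proof
    fix s assume "s \<in> \<phi> ` T"
    then obtain x y x' y' where t: "x \<in> B" "y \<in> A" "x' \<in> B" "y' \<in> A" "?f x y = ?f x' y'"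
      and s: "s = \<phi> (x, y, x')" by (auto simp: T_def)
    have C: "x [^] k \<in> carrier R" "y [^] k \<in> carrier R" "g x \<in> carrier R" "h y \<in> carrier R"
      "w x' \<in> carrier R" "inv (g x) \<in> carrier R" "g x \<otimes> inv (g x) = \<one>" "x \<in> A"
      using t AR[of x] AR[of y] wR[of x'] B by auto
    have "w x' \<otimes> ?f x y \<otimes> inv (g x)
        = (g x \<otimes> inv (g x)) \<otimes> (w x' \<otimes> h y \<otimes> x [^] k \<oplus> w x' \<otimes> h y \<otimes> y [^] k)"
      using C(1-6) by algebra
    then have "w x' \<otimes> ?f x y \<otimes> inv (g x) = w x' \<otimes> h y \<otimes> x [^] k \<oplus> w x' \<otimes> h y \<otimes> y [^] k"
      using C by simp
    moreover have "w x' \<otimes> ?f x y \<in> Y" using t Y(2)[of x' y'] by simp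
    then have "(x [^] k, w x' \<otimes> ?f x y \<otimes> inv (g x)) \<in> P"
      unfolding P_def using C by (intro image_eqI[of _ _ "(x, w x' \<otimes> ?f x y)"]) auto
    moreover have "(w x' \<otimes> h y, w x' \<otimes> h y \<otimes> y [^] k) \<in> L"
      unfolding L_def using t by (intro image_eqI[of _ _ "(x', y)"]) auto
    ultimately show "s \<in> I" by (simp add: I_def s \<phi>_def)
  qed
  have fibre: "card {s' \<in> T. \<phi> s' = \<phi> s} \<le> k * (k * m)" if "s \<in> T" for s
  proof -
    obtain x y x' where s: "s = (x, y, x')" and t: "x \<in> B" "y \<in> A" "x' \<in> B"
      using \<open>s \<in> T\<close> by (auto simp: T_def)
    define a where "a = w x' \<otimes> h y"
    have aU: "a \<in> Units R" using t AR[of y] wR[of x'] by (simp add: a_def)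
    let ?S = "SIGMA x1:{x1 \<in> A. x1 [^] k = x [^] k}. SIGMA y1:{y1 \<in> A. y1 [^] k = y [^] k}.
                {x2 \<in> B. w x2 = a \<otimes> inv (h y1)}"
    have "{s' \<in> T. \<phi> s' = \<phi> s} \<subseteq> ?S"
    proof
      fix s' assume s': "s' \<in> {s' \<in> T. \<phi> s' = \<phi> s}"
      then obtain x1 y1 x2 where s1: "s' = (x1, y1, x2)" and t1: "x1 \<in> B" "y1 \<in> A" "x2 \<in> B"
        by (auto simp: T_def)
      have eq: "x1 [^] k = x [^] k" "w x2 \<otimes> h y1 = a" "a \<otimes> y1 [^] k = a \<otimes> y [^] k"
        using s' by (auto simp: s s1 \<phi>_def a_def)
      have "y1 [^] k = y [^] k"
        using eq(3) aU AR[of y] AR[of y1] t t1 by simp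
      moreover have "w x2 = a \<otimes> inv (h y1)"
        using eq(2)[symmetric] AR[of y1] wR[of x2] t1 by (simp add: m_assoc Units_closed)
      ultimately show "s' \<in> ?S" using eq(1) t1 B by (auto simp: s1)
    qed
    then have "card {s' \<in> T. \<phi> s' = \<phi> s} \<le> card ?S"
      by (intro card_mono) (use finA finB in auto)
    also have "\<dots> \<le> card {x1 \<in> A. x1 [^] k = x [^] k} * (card {y1 \<in> A. y1 [^] k = y [^] k} * m)"
      using finA finB aU AR by (intro card_Sigma_le mult) auto
    also have "\<dots> \<le> k * (k * m)"
      by (intro mult_mono card_power_fibre_le[OF fin k A]) auto
    finally show ?thesis .
  qed
  have "card T \<le> k * (k * m) * card I"
    using card_le_fibre_bound[OF finT imI finI fibre] .
  then have "real (card T) \<le> real (k * (k * m) * card I)"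
    by (simp only: of_nat_le_iff)
  also have "\<dots> = (real k)\<^sup>2 * real m * real (card I)"
    by (simp add: power2_eq_square)
  also have "\<dots> \<le> (real k)\<^sup>2 * real m * (real (card A) ^ 3 * real (card Y) / real (order R)
          + sqrt (real (order R) * (real (card A) ^ 3 * real (card Y))))"
  proof (rule mult_left_mono)
    have "card P \<le> card A * card Y"
      unfolding P_def using card_image_le[of "A \<times> Y"] finA finY by (simp add: card_cartesian_product)
    moreover have "card L \<le> card A * card A"
    proof -
      have "card L \<le> card B * card A"
        unfolding L_def using card_image_le[of "B \<times> A"] finA finB by (simp add: card_cartesian_product)
      also have "\<dots> \<le> card A * card A" using card_mono[OF finA B] by simp
      finally show ?thesis .
    qed
    ultimately have "card P * card L \<le> (card A * card Y) * (card A * card A)"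
      by (rule mult_mono) auto
    then have "real (card P * card L) \<le> real ((card A * card Y) * (card A * card A))"
      by (simp only: of_nat_le_iff)
    then have PL: "real (card P) * real (card L) \<le> real (card A) ^ 3 * real (card Y)"
      by (simp add: power3_eq_cube mult_ac)
    have "P \<subseteq> carrier R \<times> carrier R" "L \<subseteq> carrier R \<times> carrier R"
      using AR AR(3)[THEN Units_closed] wR[THEN Units_closed] Y(1) B by (auto simp: P_def L_def)
    then have "real (card I) \<le> real (card P) * real (card L) / real (order R)
            + sqrt (real (order R) * (real (card P) * real (card L)))"
      unfolding I_def by (rule affine_incidence_bound[OF fin])
    also have "\<dots> \<le> real (card A) ^ 3 * real (card Y) / real (order R)
          + sqrt (real (order R) * (real (card A) ^ 3 * real (card Y)))"
      using PL by (intro add_mono divide_right_mono real_sqrt_le_mono mult_left_mono) auto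
    finally show "real (card I) \<le> real (card A) ^ 3 * real (card Y) / real (order R)
          + sqrt (real (order R) * (real (card A) ^ 3 * real (card Y)))" .
  qed simp
  finally show ?thesis unfolding T_def .
qed

text \<open>
The triple counts from below and from above combined. The lower bound on \<open>card A\<close> makes at least half
of \<open>A\<close> available after the zeros of \<open>w\<close>, whose lines would all collapse to the horizontal axis,
are removed.
\<close>

lemma twisted_sum_image_bound:
  fixes k :: nat
  assumes fin: "finite (carrier R)" and k: "k \<ge> 1" and A: "A \<subseteq> carrier R - {\<zero>}"
    and g: "g \<in> A \<rightarrow> carrier R - {\<zero>}" and h: "h \<in> A \<rightarrow> carrier R - {\<zero>}"
    and w: "w \<in> A \<rightarrow> carrier R"
    and mult: "\<And>t. t \<in> carrier R \<Longrightarrow> card {x \<in> A. w x = t} \<le> m"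
    and large: "2 * m \<le> card A"
    and X: "finite X" "\<And>x y. x \<in> A \<Longrightarrow> y \<in> A \<Longrightarrow> twisted_sum k g h x y \<in> X"
    and Y: "Y \<subseteq> carrier R" "\<And>x y. x \<in> A \<Longrightarrow> y \<in> A \<Longrightarrow> w x \<otimes> twisted_sum k g h x y \<in> Y"
  shows "real (card A) ^ 4 \<le> 64 * real k ^ 4 * real m * real (card X)
     * (real (card A) ^ 3 * real (card Y) / real (order R)
          + sqrt (real (order R) * (real (card A) ^ 3 * real (card Y))))"
proof -
  define B where "B = {x \<in> A. w x \<noteq> \<zero>}"
  define S where "S = real (\<Sum>x\<in>B. card (twisted_sum k g h x ` A))"
  define t where "t = real (card {(x, y, x') \<in> B \<times> A \<times> B.
                        twisted_sum k g h x y \<in> twisted_sum k g h x' ` A})"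
  define E where "E = real (card A) ^ 3 * real (card Y) / real (order R)
          + sqrt (real (order R) * (real (card A) ^ 3 * real (card Y)))"
  have finA: "finite A" using finite_subset[OF A] fin by simp
  have B: "B \<subseteq> A" by (auto simp: B_def)
  have finB: "finite B" using finite_subset[OF B finA] .
  have "card A \<le> 2 * card B"
  proof -
    have "A = B \<union> {x \<in> A. w x = \<zero>}" by (auto simp: B_def)
    then have "card A \<le> card B + card {x \<in> A. w x = \<zero>}" by (metis card_Un_le)
    then show ?thesis using mult[of \<zero>] large by simp
  qed
  then have "real (card A) \<le> 2 * real (card B)" by linarith
  then have "(real (card A))\<^sup>2 \<le> (2 * real (card B))\<^sup>2" by (intro power_mono) auto
  also have "\<dots> \<le> 8 * real k * S"
    using square_card_le_sum_row_images[OF fin k A g h B] by (simp add: S_def power_mult_distrib)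
  finally have "((real (card A))\<^sup>2)\<^sup>2 \<le> (8 * real k * S)\<^sup>2" by (intro power_mono) auto
  then have "real (card A) ^ 4 \<le> 64 * (real k)\<^sup>2 * S\<^sup>2" by (simp add: power_mult_distrib)
  also have "\<dots> \<le> 64 * (real k)\<^sup>2 * (real (card X) * t)"
    unfolding S_def t_def
    by (intro mult_left_mono square_sum_row_images_le[OF finA X(1) B] X(2)) auto
  also have "\<dots> \<le> 64 * (real k)\<^sup>2 * (real (card X) * ((real k)\<^sup>2 * real m * E))"
  proof -
    have "t \<le> (real k)\<^sup>2 * real m * E"
      unfolding t_def E_def
    proof (rule card_shared_values_le[OF fin k A g h B _ _ Y(1)])
      fix t assume "t \<in> carrier R"
      then have "card {x \<in> A. w x = t} \<le> m" by (rule mult)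
      moreover have "card {x \<in> B. w x = t} \<le> card {x \<in> A. w x = t}"
        using finA B by (intro card_mono) auto
      ultimately show "card {x \<in> B. w x = t} \<le> m" by linarith
    qed (use w B Y(2) in \<open>auto simp: B_def\<close>)
    then show ?thesis by (intro mult_left_mono) auto
  qed
  also have "\<dots> = 64 * real k ^ 4 * real m * real (card X) * E"
    by (simp add: power2_eq_square power4_eq_xxxx mult_ac)
  finally show ?thesis unfolding E_def .
qed

end

section \<open>Growth exponents\<close>

text \<open>
One of the two terms of the incidence bound is at least half of the sum.
\<close>

lemma incidence_dichotomy:
  fixes N q M D :: real
  assumes N: "N > 0" and q: "q > 0" and M: "M \<ge> 0" and D: "D > 0"
    and bound: "N ^ 4 \<le> D * M * (N ^ 3 * M / q + sqrt (q * (N ^ 3 * M)))"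
  shows "N * q \<le> 2 * D * M\<^sup>2 \<or> N ^ 5 \<le> 4 * D\<^sup>2 * q * M ^ 3"
proof (rule disjCI)
  assume "\<not> N ^ 5 \<le> 4 * D\<^sup>2 * q * M ^ 3"
  then have "N ^ 3 * (4 * D\<^sup>2 * q * M ^ 3) < N ^ 3 * N ^ 5"
    using N by (intro mult_strict_left_mono) auto
  moreover have "(2 * (D * M * sqrt (q * (N ^ 3 * M))))\<^sup>2 = N ^ 3 * (4 * D\<^sup>2 * q * M ^ 3)"
    using N q M by (simp add: power_mult_distrib power3_eq_cube power2_eq_square)
  ultimately have "(2 * (D * M * sqrt (q * (N ^ 3 * M))))\<^sup>2 < (N ^ 4)\<^sup>2"
    by (simp flip: power_add power_mult)
  then have "2 * (D * M * sqrt (q * (N ^ 3 * M))) < N ^ 4"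
    by (rule power2_less_imp_less) (use N in simp)
  then have "N ^ 4 \<le> 2 * (D * M * (N ^ 3 * M / q))"
    using bound by (simp add: distrib_left)
  then have "N ^ 4 * q \<le> 2 * D * M\<^sup>2 * N ^ 3"
    using q by (simp add: field_simps power2_eq_square)
  then have "(N * q) * N ^ 3 \<le> (2 * D * M\<^sup>2) * N ^ 3"
    by (simp add: power4_eq_xxxx power3_eq_cube mult_ac)
  then show "N * q \<le> 2 * D * M\<^sup>2"
    using N by (subst (asm) mult_le_cancel_right_pos) auto
qed

lemma powr_growth_from_power:
  fixes a N M s e :: real and n :: nat
  assumes a: "a > 0" and N: "N \<ge> 1" and M: "M \<ge> 0" and n: "n \<ge> 1"
    and e: "real n * s \<le> e" and le: "a * N powr e \<le> M ^ n"
  shows "a powr (1 / real n) * N powr s \<le> M"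
proof (rule power_le_imp_le_base)
  have "(a powr (1 / real n) * N powr s) ^ n = a * N powr (real n * s)"
    using a N n by (simp add: power_mult_distrib powr_powr flip: powr_realpow)
       (simp add: powr_powr powr_power mult.commute)
  also have "\<dots> \<le> a * N powr e"
    using a N e by (intro mult_left_mono powr_mono) auto
  also have "\<dots> \<le> M ^ n" by (rule le)
  finally show "(a powr (1 / real n) * N powr s) ^ Suc (n - 1) \<le> M ^ Suc (n - 1)"
    using n by simp
qed (rule M)

text \<open>
With \<open>\<beta> = 1 / \<alpha>\<close>, the two branches of the dichotomy give \<open>M\<close> the exponents \<open>(1 + \<beta>) / 2\<close> and
\<open>(5 - \<beta>) / 3\<close>, and \<open>\<Delta>\<close> is the smaller excess of these over 1. The constant \<open>\<kappa>\<close> is the least of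
three: one for each branch, and one for sets of at most \<open>2 K\<close> elements, where \<open>w\<close> might vanish on
most of \<open>A\<close> and the trivial bound \<open>M \<ge> 1\<close> is used.
\<close>

theorem theorem2p5:
  fixes \<alpha> :: real
  assumes "1 / 2 < \<alpha>" and "\<alpha> < 1"
  shows "\<exists>\<Delta>::real. \<Delta> > 0 \<and>
    (\<forall>(k::nat) (K::real) (c1::real) (c2::real).
      k \<ge> 1 \<longrightarrow> K \<ge> 1 \<longrightarrow> 0 < c1 \<longrightarrow> c1 < c2 \<longrightarrow>
      (\<exists>\<kappa>::real. \<kappa> > 0 \<and>
        (\<forall>(p::nat) (G::int set) (g::int \<Rightarrow> int) (h::int \<Rightarrow> int) (w::int \<Rightarrow> int) (A::int set).
          prime p \<longrightarrow>
          subgroup G (Fp_star p) \<longrightarrow>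
          g \<in> G \<rightarrow> carrier (Fp_star p) \<longrightarrow>
          h \<in> G \<rightarrow> carrier (Fp_star p) \<longrightarrow>
          (\<forall>z\<in>G. real (card (ratio_values p G g z)) \<le> K
                  \<and> real (card (ratio_values p G h z)) \<le> K) \<longrightarrow>
          real (MAX u\<in>G. \<mu> p G (fun_mult p (fun_mult p g (translate p h u)) id)) \<le> K \<longrightarrow>
          w \<in> G \<rightarrow> carrier (Fp p) \<longrightarrow>
          real (\<mu> p G w) \<le> K \<longrightarrow>
          A \<subseteq> G \<longrightarrow>
          c1 * real p powr \<alpha> < real (card A) \<longrightarrow>
          real (card A) < c2 * real p powr \<alpha> \<longrightarrow>
          real (max (card (value_set (twisted_power_sum p k g h) A))
                    (card (value_set (P_op p w (twisted_power_sum p k g h)) A)))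
            \<ge> \<kappa> * real (card A) powr (1 + \<Delta>))))"
proof -
  define \<beta> where "\<beta> = 1 / \<alpha>"
  have \<beta>: "1 < \<beta>" "\<beta> < 2" using assms by (simp_all add: \<beta>_def field_simps)
  define \<Delta> where "\<Delta> = min ((\<beta> - 1) / 2) ((2 - \<beta>) / 3)"
  have \<Delta>: "\<Delta> > 0" "2 * (1 + \<Delta>) \<le> 1 + \<beta>" "3 * (1 + \<Delta>) \<le> 5 - \<beta>"
    using \<beta> by (auto simp: \<Delta>_def min_def field_simps)
  show ?thesis
  proof (rule exI[of _ \<Delta>], intro conjI \<Delta>(1) allI impI)
    fix k :: nat and K c1 c2 :: real
    assume k: "k \<ge> 1" and K: "K \<ge> 1" and c: "0 < c1" "c1 < c2"
    define D where "D = 64 * real k ^ 4 * K"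
    define a2 where "a2 = c2 powr (- \<beta>) / (2 * D)"
    define a3 where "a3 = c1 powr \<beta> / (4 * D\<^sup>2)"
    define \<kappa> where "\<kappa> = min ((2 * K) powr (- (1 + \<Delta>))) (min (a2 powr (1 / 2)) (a3 powr (1 / 3)))"
    have D: "D > 0" using k K by (simp add: D_def)
    have a: "a2 > 0" "a3 > 0" using D c by (simp_all add: a2_def a3_def)
    have \<kappa>: "\<kappa> > 0" "\<kappa> \<le> (2 * K) powr (- (1 + \<Delta>))" "\<kappa> \<le> a2 powr (1 / 2)" "\<kappa> \<le> a3 powr (1 / 3)"
      using a K by (simp_all add: \<kappa>_def)
    show "\<exists>\<kappa>::real. \<kappa> > 0 \<and>
        (\<forall>(p::nat) (G::int set) (g::int \<Rightarrow> int) (h::int \<Rightarrow> int) (w::int \<Rightarrow> int) (A::int set).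
          prime p \<longrightarrow>
          subgroup G (Fp_star p) \<longrightarrow>
          g \<in> G \<rightarrow> carrier (Fp_star p) \<longrightarrow>
          h \<in> G \<rightarrow> carrier (Fp_star p) \<longrightarrow>
          (\<forall>z\<in>G. real (card (ratio_values p G g z)) \<le> K
                  \<and> real (card (ratio_values p G h z)) \<le> K) \<longrightarrow>
          real (MAX u\<in>G. \<mu> p G (fun_mult p (fun_mult p g (translate p h u)) id)) \<le> K \<longrightarrow>
          w \<in> G \<rightarrow> carrier (Fp p) \<longrightarrow>
          real (\<mu> p G w) \<le> K \<longrightarrow>
          A \<subseteq> G \<longrightarrow>
          c1 * real p powr \<alpha> < real (card A) \<longrightarrow>
          real (card A) < c2 * real p powr \<alpha> \<longrightarrow>
          real (max (card (value_set (twisted_power_sum p k g h) A))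
                    (card (value_set (P_op p w (twisted_power_sum p k g h)) A)))
            \<ge> \<kappa> * real (card A) powr (1 + \<Delta>))"
    proof (rule exI[of _ \<kappa>], intro conjI \<kappa>(1) allI impI)
      fix p :: nat and G :: "int set" and g h w :: "int \<Rightarrow> int" and A :: "int set"
      assume p: "prime p" and G: "subgroup G (Fp_star p)"
        and g: "g \<in> G \<rightarrow> carrier (Fp_star p)" and h: "h \<in> G \<rightarrow> carrier (Fp_star p)"
        and w: "w \<in> G \<rightarrow> carrier (Fp p)" and mu: "real (\<mu> p G w) \<le> K"
        and A: "A \<subseteq> G" and lo: "c1 * real p powr \<alpha> < real (card A)"
        and hi: "real (card A) < c2 * real p powr \<alpha>"
      interpret residues_prime p "Fp p"
        by unfold_locales (simp_all add: p)
      define X where "X = value_set (twisted_power_sum p k g h) A"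
      define Y where "Y = value_set (P_op p w (twisted_power_sum p k g h)) A"
      define N where "N = real (card A)"
      define M where "M = real (max (card X) (card Y))"
      have p0: "real p > 0" using p by (simp add: prime_gt_0_nat)
      have GR: "G \<subseteq> carrier (Fp p) - {\<zero>\<^bsub>Fp p\<^esub>}"
        using subgroup.subset[OF G] by simp
      have fin: "finite (carrier (Fp p))" by (rule finite)
      have finG: "finite G" using finite_subset[OF GR] fin by simp
      have finA: "finite A" using finite_subset[OF A finG] .
      have AR: "x \<in> carrier (Fp p)" "g x \<in> carrier (Fp p)" "h x \<in> carrier (Fp p)" "w x \<in> carrier (Fp p)"
        if "x \<in> A" for x using that A GR g h w by auto
      have Xf: "finite X"
      proof -
        have "X = (\<lambda>(x, y). twisted_power_sum p k g h x y) ` (A \<times> A)"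
          by (auto simp: X_def value_set_def)
        then show ?thesis using finA by simp
      qed
      have ordp: "order (Fp p) = p"
        by (simp add: order_def res_carrier_eq)
      have Nlo: "c1 * real p powr \<alpha> < N" and Nhi: "N < c2 * real p powr \<alpha>"
        using lo hi by (simp_all add: N_def)
      have "N > 0" using Nlo c p0 by (smt (verit) mult_pos_pos powr_gt_zero)
      then have N1: "N \<ge> 1" and Ane: "A \<noteq> {}" by (auto simp: N_def)
      have M1: "M \<ge> 1"
      proof -
        obtain x where "x \<in> A" using Ane by auto
        then have "twisted_power_sum p k g h x x \<in> X" by (auto simp: X_def value_set_def)
        then have "card X \<ge> 1" using Xf by (auto simp: Suc_le_eq card_gt_0_iff)
        then show ?thesis by (simp add: M_def)
      qed
      have p_powr: "(real p powr \<alpha>) powr \<beta> = real p"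
        using p0 assms by (simp add: powr_powr \<beta>_def)
      have "\<kappa> * N powr (1 + \<Delta>) \<le> M"
      proof (cases "2 * \<mu> p G w \<le> card A")
        case False
        then have "N \<le> 2 * K" using mu by (simp add: N_def)
        then have "N powr (1 + \<Delta>) \<le> (2 * K) powr (1 + \<Delta>)"
          using N1 \<Delta> by (intro powr_mono2) auto
        then have "\<kappa> * N powr (1 + \<Delta>) \<le> (2 * K) powr (- (1 + \<Delta>)) * (2 * K) powr (1 + \<Delta>)"
          using \<kappa> by (intro mult_mono) auto
        also have "\<dots> = 1" using K by (simp flip: powr_add)
        finally show ?thesis using M1 by linarith
      next
        case True
        have mult: "card {x \<in> A. w x = t} \<le> \<mu> p G w" if "t \<in> carrier (Fp p)" for t
        proof -
          have "card {x \<in> A. w x = t} \<le> card {x \<in> G. w x = t}"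
            using finG A by (intro card_mono) auto
          also have "\<dots> \<le> \<mu> p G w"
            unfolding max_mult_def using that fin by (intro Max_ge) auto
          finally show ?thesis .
        qed
        have "N ^ 4 \<le> 64 * real k ^ 4 * real (\<mu> p G w) * real (card X)
          * (N ^ 3 * real (card Y) / real (order (Fp p))
               + sqrt (real (order (Fp p)) * (N ^ 3 * real (card Y))))"
          unfolding N_def
        proof (rule twisted_sum_image_bound[where g = g and h = h and w = w])
          show "twisted_sum k g h x y \<in> X" if "x \<in> A" "y \<in> A" for x y
            using that by (auto simp: X_def value_set_def twisted_power_sum_def)
          show "w x \<otimes>\<^bsub>Fp p\<^esub> twisted_sum k g h x y \<in> Y" if "x \<in> A" "y \<in> A" for x y
            using that by (auto simp: Y_def value_set_def twisted_power_sum_def P_op_def)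
          show "Y \<subseteq> carrier (Fp p)"
            using AR by (auto simp: Y_def value_set_def twisted_power_sum_def P_op_def)
        qed (use fin k A GR g h w mult True Xf in auto)
        also have "\<dots> \<le> D * M * (N ^ 3 * M / real p + sqrt (real p * (N ^ 3 * M)))"
          unfolding D_def ordp using mu K N1 p0
          by (intro mult_mono add_mono divide_right_mono real_sqrt_le_mono) (auto simp: M_def)
        finally have "N * real p \<le> 2 * D * M\<^sup>2 \<or> N ^ 5 \<le> 4 * D\<^sup>2 * real p * M ^ 3"
          using N1 M1 p0 D by (intro incidence_dichotomy) auto
        then show ?thesis
        proof
          assume le: "N * real p \<le> 2 * D * M\<^sup>2"
          have "N powr \<beta> \<le> (c2 * real p powr \<alpha>) powr \<beta>"
            using Nhi N1 \<beta> by (intro powr_mono2) auto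
          also have "\<dots> = c2 powr \<beta> * real p" using c by (simp add: powr_mult p_powr)
          finally have "N * (c2 powr (- \<beta>) * N powr \<beta>) \<le> N * real p"
            using N1 c by (intro mult_left_mono) (auto simp: powr_minus field_simps)
          from order.trans[OF this le]
          have "c2 powr (- \<beta>) * N powr (1 + \<beta>) \<le> 2 * D * M\<^sup>2"
            using N1 by (simp add: powr_add mult_ac)
          then have "a2 * N powr (1 + \<beta>) \<le> M ^ 2"
            using D by (simp add: a2_def field_simps)
          then have "a2 powr (1 / real 2) * N powr (1 + \<Delta>) \<le> M"
            using a N1 M1 \<Delta> by (intro powr_growth_from_power[where e = "1 + \<beta>"]) auto
          moreover have "\<kappa> * N powr (1 + \<Delta>) \<le> a2 powr (1 / 2) * N powr (1 + \<Delta>)"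
            using \<kappa> by (intro mult_right_mono) auto
          ultimately show ?thesis by simp
        next
          assume le: "N ^ 5 \<le> 4 * D\<^sup>2 * real p * M ^ 3"
          have "c1 powr \<beta> * real p = (c1 * real p powr \<alpha>) powr \<beta>"
            using c by (simp add: powr_mult p_powr)
          also have "\<dots> \<le> N powr \<beta>"
            using Nlo c \<beta> p0 by (intro powr_mono2) auto
          finally have cp: "c1 powr \<beta> * real p \<le> N powr \<beta>" .
          have "c1 powr \<beta> * N powr 5 \<le> (4 * D\<^sup>2 * M ^ 3) * (c1 powr \<beta> * real p)"
            using mult_left_mono[OF le, of "c1 powr \<beta>"] N1 by (simp add: powr_numeral mult_ac)
          also have "\<dots> \<le> (4 * D\<^sup>2 * M ^ 3) * N powr \<beta>"
            using cp M1 by (intro mult_left_mono) auto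
          finally have "a3 * N powr (5 - \<beta>) \<le> M ^ 3"
            using D N1 by (simp add: a3_def powr_diff field_simps)
          then have "a3 powr (1 / real 3) * N powr (1 + \<Delta>) \<le> M"
            using a N1 M1 \<Delta> by (intro powr_growth_from_power[where e = "5 - \<beta>"]) auto
          moreover have "\<kappa> * N powr (1 + \<Delta>) \<le> a3 powr (1 / 3) * N powr (1 + \<Delta>)"
            using \<kappa> by (intro mult_right_mono) auto
          ultimately show ?thesis by simp
        qed
      qed
      then show "real (max (card (value_set (twisted_power_sum p k g h) A))
                    (card (value_set (P_op p w (twisted_power_sum p k g h)) A)))
            \<ge> \<kappa> * real (card A) powr (1 + \<Delta>)"
        by (simp add: M_def N_def X_def Y_def)
    qed
  qed
qed

end
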